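(* Let $[a,b]$ be a non-trivial segment of $\mathbb{T}$, $\omega_y=\mathbb{T}\setminus[a,b]$ and $T>0$. The equation $(\partial_t+D)f=\mathbf 1_{\omega_y}u$ is not null-controllable on $\omega_y$ in time $T$.
   Context: $\mathbb{T}=\mathbb{R}/2\pi\mathbb{Z}$. Consider the Hilbert space $\{\sum_{n\ge0}a_ne^{iny}:\ \sum|a_n|^2<+\infty\}$, and let $D$ be the unbounded operator on it with domain $\{\sum_{n\ge 0} a_ne^{iny}:\ \sum n^2|a_n|^2<+\infty\}$ defined by $D\left(\sum a_ne^{iny}\right)=\sum na_ne^{iny}$. Null-controllability of $(\partial_t+D)f=\mathbf 1_{\omega_y}u$ on $\omega_y$ in time $T$ is understood through its equivalent (dual) observability inequality: there exists $C>0$ such that for all sequences $(a_n)_{n\ge0}$ of complex numbers with $\sum|a_n|^2<+\infty$, $$\sum_{n\ge0}|a_n|^2e^{-2nT}\le C\int_{[0,T]\times\omega_y}\Big|\sum_{n\ge0}a_ne^{-nt+iny}\Big|^2\,dt\,dy.$$ *)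

theory Defs
  imports "HOL-Analysis.Analysis"
begin

text \<open>
  The torus \<open>\<real>/2\<pi>\<int>\<close> is handled through its covering \<open>\<real>\<close>: a subset of it is represented by
  its (\<open>2\<pi>\<close>-periodic) preimage in \<open>\<real>\<close>, complements are taken in \<open>\<real>\<close>, and Lebesgue measure
  on the torus is Lebesgue measure on the fundamental domain \<open>[0, 2\<pi>)\<close>.
\<close>

definition torus_segment :: "real \<Rightarrow> real \<Rightarrow> real set" where
  "torus_segment a b = {y. \<exists>k::int. y + 2 * pi * of_int k \<in> {a..b}}"

text \<open>
  An element \<open>\<Sum> a\<^sub>n e\<^sup>i\<^sup>n\<^sup>y\<close> of the state space is represented by its square-summable
  coefficient sequence. The operator \<open>D\<close> acts as multiplication of the \<open>n\<close>-th coefficient by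
  \<open>n\<close>, so the function below is the solution of \<open>(\<partial>\<^sub>t + D) g = 0\<close> with that initial datum.
  For \<open>t > 0\<close> the series converges absolutely; for \<open>t = 0\<close> it need not converge pointwise,
  but \<open>{0} \<times> \<real>\<close> is a null set in the integral below.
\<close>

definition free_solution :: "(nat \<Rightarrow> complex) \<Rightarrow> real \<Rightarrow> real \<Rightarrow> complex" where
  "free_solution a t y =
     (\<Sum>n. a n * exp (- of_real (real n * t) + \<i> * of_real (real n * y)))"

text \<open>
  Null-controllability of \<open>(\<partial>\<^sub>t + D) f = 1\<^sub>\<omega> u\<close> on \<open>\<omega>\<close> in time \<open>T\<close>, in its dual form as an
  observability inequality; \<open>\<omega>\<close> is a \<open>2\<pi>\<close>-periodic set. For square-summable \<open>a\<close> and
  Borel \<open>\<omega>\<close> the integrand is integrable: by Parseval, its integral over the whole torus is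
  \<open>2\<pi> \<Sum> |a\<^sub>n|\<^sup>2 e\<^sup>-\<^sup>2\<^sup>n\<^sup>t\<close> at each time \<open>t > 0\<close>.
\<close>

definition null_controllable :: "real set \<Rightarrow> real \<Rightarrow> bool" where
  "null_controllable \<omega> T \<longleftrightarrow>
     (\<exists>C>0. \<forall>a :: nat \<Rightarrow> complex. summable (\<lambda>n. (cmod (a n))\<^sup>2) \<longrightarrow>
        (\<Sum>n. (cmod (a n))\<^sup>2 * exp (- 2 * real n * T))
          \<le> C * (LINT p:{0..T} \<times> (\<omega> \<inter> {0..<2 * pi})|lborel.
                    (cmod (free_solution a (fst p) (snd p)))\<^sup>2))"

end

theory Submission
  imports Defs "HOL-Computational_Algebra.Polynomial"
begin

text \<open>
  In the variable \<open>z = e\<^sup>-\<^sup>t\<^sup>+\<^sup>i\<^sup>y\<close> a finitely supported solution is a polynomial \<open>f\<close>, and the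
  observation region becomes an annular sector \<open>K\<close> not meeting the ray from \<open>0\<close> through the middle
  of the missing arc. The left-hand side of the observability inequality is at least \<open>|f 0|\<^sup>2\<close>.
  Pushing the pole of \<open>1/(z - w)\<close> along this ray from infinity to \<open>w = 0\<close>, as in Runge's theorem,
  gives polynomials \<open>p\<close> approximating \<open>1/z\<close> uniformly on \<open>K\<close>; then \<open>f z = 1 - z p(z)\<close> equals \<open>1\<close> at
  the origin and is arbitrarily small on \<open>K\<close>.
\<close>

section \<open>Polynomial approximation of \<open>1 / (z - w)\<close> by moving the pole\<close>

text \<open>The error is measured relative to \<open>1 / (z - w)\<close>: this form avoids division
  and composes well when the pole moves. At \<open>w = 0\<close> it bounds
  \<open>z * poly p z - 1\<close> directly.\<close>

definition reciprocal_approx :: "complex set \<Rightarrow> complex \<Rightarrow> bool" where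
  "reciprocal_approx K w \<longleftrightarrow>
     (\<forall>\<epsilon>>0. \<exists>p :: complex poly. \<forall>z\<in>K. cmod ((z - w) * poly p z - 1) \<le> \<epsilon>)"

text \<open>Truncate the geometric series of \<open>1 / (z - w)\<close> in powers of
  \<open>z / w\<close>, whose modulus is at most \<open>1/2\<close> on \<open>K\<close>.\<close>

lemma reciprocal_approx_far:
  assumes K: "\<And>z. z \<in> K \<Longrightarrow> cmod z \<le> 1" and w: "cmod w \<ge> 2"
  shows "reciprocal_approx K w"
  unfolding reciprocal_approx_def
proof (intro allI impI)
  fix \<epsilon> :: real assume "\<epsilon> > 0"
  then obtain m where m: "(1/2) ^ m < \<epsilon>"
    using real_arch_pow_inv[of \<epsilon> "1/2"] by auto
  define p where "p = (\<Sum>k<m. [:0, 1 / w:] ^ k) * [:- 1 / w:]"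
  have "cmod ((z - w) * poly p z - 1) \<le> \<epsilon>" if "z \<in> K" for z
  proof -
    have w0: "w \<noteq> 0" using w by auto
    have "(z - w) * poly p z = (1 - z / w) * (\<Sum>k<m. (z / w) ^ k)"
      using w0 by (simp add: p_def poly_sum field_simps)
    also have "\<dots> = 1 - (z / w) ^ m"
      by (rule one_diff_power_eq[symmetric])
    finally have "cmod ((z - w) * poly p z - 1) = cmod (z / w) ^ m"
      by (simp add: norm_power)
    also have "cmod (z / w) \<le> 1 / 2"
      using K[OF that] w by (simp add: norm_divide divide_simps)
    hence "cmod (z / w) ^ m \<le> (1/2) ^ m"
      by (intro power_mono) auto
    finally show ?thesis using m by simp
  qed
  thus "\<exists>p. \<forall>z\<in>K. cmod ((z - w) * poly p z - 1) \<le> \<epsilon>" by blast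
qed

text \<open>With \<open>s = w' - w\<close>, the reciprocal \<open>1 / (z - w')\<close> is
  \<open>1 / (z - w)\<close> times the geometric series in \<open>s / (z - w)\<close>, a ratio of
  modulus at most \<open>1/2\<close> on \<open>K\<close>. Replacing each \<open>1 / (z - w)\<close>
  by its polynomial approximation and truncating leaves a polynomial.\<close>

lemma reciprocal_approx_step:
  assumes w: "reciprocal_approx K w"
    and near: "\<And>z. z \<in> K \<Longrightarrow> 2 * cmod (w' - w) \<le> cmod (z - w)"
    and off: "w \<notin> K"
  shows "reciprocal_approx K w'"
  unfolding reciprocal_approx_def
proof (intro allI impI)
  fix \<epsilon> :: real assume \<epsilon>: "\<epsilon> > 0"
  obtain m where m: "(3/4) ^ m < \<epsilon> / 2"
    using real_arch_pow_inv[of "\<epsilon> / 2" "3/4"] \<epsilon> by auto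
  \<comment> \<open>The bound \<open>1/2\<close> keeps the perturbed ratio \<open>u\<close> below
    \<open>1/2 * 3/2 = 3/4\<close>, so its geometric sums stay below \<open>4\<close>. The bound
    \<open>\<epsilon> / 8\<close> then makes the inherited error at most
    \<open>\<epsilon> / 2\<close>; the other half is for truncation.\<close>
  define \<eta> where "\<eta> = min (1/2) (\<epsilon> / 8)"
  have \<eta>: "\<eta> > 0" "\<eta> \<le> 1/2" "4 * \<eta> \<le> \<epsilon> / 2" using \<epsilon> by (auto simp: \<eta>_def)
  obtain p where p: "\<And>z. z \<in> K \<Longrightarrow> cmod ((z - w) * poly p z - 1) \<le> \<eta>"
    using w \<eta>(1) unfolding reciprocal_approx_def by blast
  define s where "s = w' - w"
  define q where "q = p * (\<Sum>k<m. (smult s p) ^ k)"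
  have "cmod ((z - w') * poly q z - 1) \<le> \<epsilon>" if z: "z \<in> K" for z
  proof -
    define u where "u = s * poly p z"
    define e where "e = (z - w) * poly p z - 1"
    have e: "cmod e \<le> \<eta>" using p[OF z] by (simp add: e_def)
    have zw: "cmod (z - w) > 0" using z off by auto
    have "u = s / (z - w) * (1 + e)"
      using zw by (simp add: u_def e_def)
    hence "cmod u = cmod s / cmod (z - w) * cmod (1 + e)"
      by (simp add: norm_mult norm_divide)
    also have "\<dots> \<le> (1/2) * (3/2)"
    proof (rule mult_mono)
      show "cmod s / cmod (z - w) \<le> 1/2"
        using near[OF z] zw by (simp add: s_def divide_simps)
      show "cmod (1 + e) \<le> 3/2"
        using norm_triangle_ineq[of 1 e] e \<eta>(2) by simp
    qed auto
    finally have u: "cmod u \<le> 3/4" by simp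
    \<comment> \<open>Since \<open>(z - w) * poly p z = 1 + e\<close>, the product telescopes up to
      the truncation error \<open>u ^ m\<close> and the old error \<open>e\<close> multiplied by the
      geometric sum.\<close>
    have "(z - w') * poly q z = ((z - w) * poly p z - u) * (\<Sum>k<m. u ^ k)"
      by (simp add: q_def u_def s_def poly_sum algebra_simps)
    also have "\<dots> = (1 - u) * (\<Sum>k<m. u ^ k) + e * (\<Sum>k<m. u ^ k)"
      by (simp add: e_def algebra_simps)
    also have "(1 - u) * (\<Sum>k<m. u ^ k) = 1 - u ^ m"
      by (rule one_diff_power_eq[symmetric])
    finally have "cmod ((z - w') * poly q z - 1) = cmod (e * (\<Sum>k<m. u ^ k) - u ^ m)"
      by simp
    also have "\<dots> \<le> cmod e * cmod (\<Sum>k<m. u ^ k) + cmod u ^ m"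
      by (metis norm_mult norm_power norm_triangle_ineq4)
    also have "\<dots> \<le> \<eta> * 4 + (3/4) ^ m"
    proof (intro add_mono mult_mono power_mono)
      have "cmod (\<Sum>k<m. u ^ k) \<le> (\<Sum>k<m. (3/4) ^ k)"
        by (intro sum_norm_le) (simp only: norm_power power_mono[OF u norm_ge_zero])
      also have "\<dots> \<le> 4"
        by (simp add: sum_gp_strict)
      finally show "cmod (\<Sum>k<m. u ^ k) \<le> 4" .
    qed (use e u \<eta> in auto)
    also have "\<dots> \<le> \<epsilon>" using \<eta>(3) m by simp
    finally show ?thesis .
  qed
  thus "\<exists>p. \<forall>z\<in>K. cmod ((z - w') * poly p z - 1) \<le> \<epsilon>" by blast
qed

text \<open>The pole walks along the ray from \<open>2 * v\<close> to \<open>0\<close>. As the whole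
  ray keeps distance \<open>\<delta>\<close> from \<open>K\<close>, one step length works throughout
  and finitely many steps suffice.\<close>

lemma reciprocal_approx_zero:
  fixes v :: complex
  assumes K: "\<And>z. z \<in> K \<Longrightarrow> cmod z \<le> 1" and v: "cmod v = 1" and "\<delta> > 0"
    and away: "\<And>z r. z \<in> K \<Longrightarrow> r \<ge> 0 \<Longrightarrow> \<delta> \<le> cmod (z - of_real r * v)"
  shows "reciprocal_approx K 0"
proof -
  \<comment> \<open>The step length \<open>2 / N\<close> is thereby at most half of
    \<open>\<delta>\<close>.\<close>
  obtain N :: nat where N: "2 * (2 / \<delta>) < real N"
    using reals_Archimedean2 by blast
  hence N0: "N > 0" using \<open>\<delta> > 0\<close> by (cases N) (auto simp: divide_simps)
  define W where "W j = of_real (2 * real (N - j) / real N) * v" for j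
  have "reciprocal_approx K (W j)" if "j \<le> N" for j
    using that
  proof (induction j)
    case 0
    show ?case
      by (rule reciprocal_approx_far[OF K]) (use v N0 in \<open>auto simp: W_def norm_mult\<close>)
  next
    case (Suc j)
    have away': "\<delta> \<le> cmod (z - W j)" if "z \<in> K" for z
      unfolding W_def by (rule away[OF that]) simp
    have "W (Suc j) - W j = of_real (- 2 / real N) * v"
      using Suc.prems N0
      by (simp add: W_def of_nat_diff flip: left_diff_distrib of_real_diff diff_divide_distrib)
    hence "cmod (W (Suc j) - W j) = 2 / real N"
      by (simp add: norm_mult v norm_divide)
    moreover have "2 * (2 / real N) \<le> \<delta>"
      using N N0 \<open>\<delta> > 0\<close> by (simp add: field_simps)
    ultimately have near: "2 * cmod (W (Suc j) - W j) \<le> cmod (z - W j)" if "z \<in> K" for z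
      using away'[OF that] by simp
    have "W j \<notin> K" using away' \<open>\<delta> > 0\<close> by force
    have "reciprocal_approx K (W j)" using Suc by simp
    thus ?case
      by (rule reciprocal_approx_step) fact+
  qed
  from this[of N] show ?thesis by (simp add: W_def)
qed

section \<open>Distance from the observation region to the ray\<close>

text \<open>The complementary arc is centred at the antipode \<open>(a + b) / 2 + pi\<close> and has
  half-width \<open>pi - (b - a) / 2\<close>. Measured from there, angles stay in
  \<open>[0, pi]\<close>, where the cosine decreases.\<close>

lemma cos_le_off_torus_segment:
  assumes "a < b" "b < a + 2 * pi" "y \<notin> torus_segment a b"
  shows "cos (y - (a + b) / 2) \<le> cos ((b - a) / 2)"
proof -
  \<comment> \<open>This shift brings \<open>y\<close> to its representative \<open>x\<close> in
    \<open>[a, a + 2 * pi)\<close>.\<close>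
  define k where "k = - \<lfloor>(y - a) / (2 * pi)\<rfloor>"
  define x where "x = y + 2 * pi * of_int k"
  have "x = y - of_int \<lfloor>(y - a) / (2 * pi)\<rfloor> * (2 * pi)"
    by (simp add: x_def k_def)
  hence "a \<le> x" "x < a + 2 * pi"
    using floor_divide_lower[of "2 * pi" "y - a"] floor_divide_upper[of "2 * pi" "y - a"]
    unfolding distrib_right by simp_all
  moreover have "x \<notin> {a..b}"
    using assms(3) by (auto simp: torus_segment_def x_def)
  ultimately have x: "b < x" "x < a + 2 * pi" by auto
  have "x - (a + b) / 2 = y - (a + b) / 2 + of_int k * (2 * pi)"
    by (simp add: x_def)
  hence "cos (y - (a + b) / 2) = cos (x - (a + b) / 2)"
    using cos.plus_of_int[of "y - (a + b) / 2" k] by (simp only: of_real_eq_id id_apply)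
  also have "\<dots> = - cos \<bar>x - (a + b) / 2 - pi\<bar>"
    unfolding cos_abs_real by (simp add: cos_minus_pi)
  also have "\<dots> \<le> - cos (pi - (b - a) / 2)"
  proof (intro le_imp_neg_le cos_monotone_0_pi_le)
    show "\<bar>x - (a + b) / 2 - pi\<bar> \<le> pi - (b - a) / 2"
      using x by (simp add: abs_le_iff field_simps)
  qed (use assms in auto)
  finally show ?thesis by simp
qed

text \<open>By the law of cosines the squared distance is at least
  \<open>s\<^sup>2 + r\<^sup>2 - 2 * r * s * c\<close>, a combination of
  \<open>(s - r)\<^sup>2\<close> and \<open>(s + r)\<^sup>2\<close> with nonnegative weights.
  Keeping only the second square and using \<open>s + r \<ge> s\<close> gives a bound uniform in
  \<open>r\<close>.\<close>

lemma dist_ray_ge: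
  assumes "cos (y - \<theta>) \<le> c" "c \<le> 1" "r \<ge> 0" "s \<ge> 0"
  shows "sqrt ((1 - c) / 2) * s \<le> cmod (of_real s * cis y - of_real r * cis \<theta>)"
proof -
  have c: "c \<ge> -1" using assms(1) cos_ge_minus_one[of "y - \<theta>"] by linarith
  have "(sqrt ((1 - c) / 2) * s)\<^sup>2 = (1 - c) / 2 * s\<^sup>2"
    using assms by (simp add: power_mult_distrib)
  also have "\<dots> \<le> (1 + c) / 2 * (s - r)\<^sup>2 + (1 - c) / 2 * (s + r)\<^sup>2"
  proof -
    have "(1 - c) / 2 * s\<^sup>2 \<le> (1 - c) / 2 * (s + r)\<^sup>2"
      using assms by (intro mult_left_mono power_mono) auto
    moreover have "0 \<le> (1 + c) / 2 * (s - r)\<^sup>2" using c by simp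
    ultimately show ?thesis by linarith
  qed
  also have "\<dots> = s\<^sup>2 + r\<^sup>2 - 2 * (r * s) * c"
    by (simp add: power2_eq_square field_simps)
  also have "\<dots> \<le> s\<^sup>2 + r\<^sup>2 - 2 * (r * s) * cos (y - \<theta>)"
    using assms by (simp add: mult_left_mono)
  also have "\<dots> = s\<^sup>2 * ((cos y)\<^sup>2 + (sin y)\<^sup>2) + r\<^sup>2 * ((cos \<theta>)\<^sup>2 + (sin \<theta>)\<^sup>2)
                    - 2 * (r * s) * cos (y - \<theta>)"
    by simp
  also have "\<dots> = (s * cos y - r * cos \<theta>)\<^sup>2 + (s * sin y - r * sin \<theta>)\<^sup>2"
    unfolding cos_diff by algebra
  also have "\<dots> = (cmod (of_real s * cis y - of_real r * cis \<theta>))\<^sup>2"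
    by (simp add: cmod_power2)
  finally show ?thesis by (rule power2_le_imp_le) simp
qed

section \<open>Testing the observability inequality on polynomials\<close>

lemma free_solution_coeff:
  "free_solution (coeff p) t y = poly p (of_real (exp (- t)) * cis y)"
proof -
  have "free_solution (coeff p) t y =
          (\<Sum>n\<le>degree p. coeff p n * exp (- of_real (real n * t) + \<i> * of_real (real n * y)))"
    unfolding free_solution_def by (intro suminf_finite) (auto simp: coeff_eq_0)
  also have "\<dots> = (\<Sum>n\<le>degree p. coeff p n * (of_real (exp (- t)) * cis y) ^ n)"
  proof (intro sum.cong refl arg_cong2[where f = "(*)"])
    fix n
    have "of_real (exp (- t)) * cis y = exp (- of_real t + \<i> * of_real y)"
      by (simp only: cis_conv_exp exp_add exp_of_real flip: of_real_minus)
    thus "exp (- of_real (real n * t) + \<i> * of_real (real n * y))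
            = (of_real (exp (- t)) * cis y) ^ n"
      by (simp add: exp_of_nat_mult[symmetric] algebra_simps)
  qed
  finally show ?thesis by (simp add: poly_altdef)
qed

lemma set_integral_observation_le:
  fixes g :: "real \<times> real \<Rightarrow> real"
  assumes "T \<ge> 0" "B \<ge> 0" "\<And>t y. t \<in> {0..T} \<Longrightarrow> y \<in> \<omega> \<Longrightarrow> g (t, y) \<le> B"
  shows "(LINT p:{0..T} \<times> (\<omega> \<inter> {0..<2 * pi})|lborel. g p) \<le> B * (2 * pi * T)"
proof -
  have box: "{0..T} \<times> {0..2 * pi} = cbox (0, 0) (T, 2 * pi)"
    by (simp add: cbox_Pair_eq)
  have content: "measure lborel (cbox (0, 0) (T, 2 * pi)) = 2 * pi * T"
    using assms(1) by (simp add: content_Pair)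
  have "(LINT p:{0..T} \<times> (\<omega> \<inter> {0..<2 * pi})|lborel. g p)
          \<le> (LINT p|lborel. B * indicator (cbox (0, 0) (T, 2 * pi)) p)"
    unfolding set_lebesgue_integral_def
  \<comment> \<open>Only the majorant has to be shown integrable: a non-integrable integrand has
    integral \<open>0\<close> by convention, and the majorant is nonnegative.\<close>
  proof (rule integral_mono')
    show "integrable lborel (\<lambda>p. B * indicator (cbox (0, 0) (T, 2 * pi)) p :: real)"
      by (intro integrable_mult_right integrable_real_indicator emeasure_lborel_cbox_finite) auto
  qed (use assms in \<open>auto simp: indicator_def simp flip: box\<close>)
  also have "\<dots> = B * (2 * pi * T)"
    by (simp only: integral_mult_right_zero integral_indicator content) (simp add: content)
  finally show ?thesis .
qed

theorem theorem4:
  fixes a b T :: real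
  assumes "a < b" and "b < a + 2 * pi"
    and "T > 0"
  shows "\<not> null_controllable (- torus_segment a b) T"
proof
  define \<theta> where "\<theta> = (a + b) / 2"
  define c where "c = cos ((b - a) / 2)"
  define K where
    "K = {of_real (exp (- t)) * cis y | t y. t \<in> {0..T} \<and> y \<in> - torus_segment a b}"
  \<comment> \<open>The factor \<open>exp (- T)\<close> is the smallest modulus of a point of
    \<open>K\<close>.\<close>
  define \<delta> where "\<delta> = sqrt ((1 - c) / 2) * exp (- T)"
  assume "null_controllable (- torus_segment a b) T"
  then obtain C where C: "C > 0" and obs:
    "\<And>f. summable (\<lambda>n. (cmod (f n))\<^sup>2) \<Longrightarrow>
        (\<Sum>n. (cmod (f n))\<^sup>2 * exp (- 2 * real n * T))
          \<le> C * (LINT p:{0..T} \<times> (- torus_segment a b \<inter> {0..<2 * pi})|lborel.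
                    (cmod (free_solution f (fst p) (snd p)))\<^sup>2)"
    unfolding null_controllable_def by blast
  have c: "c < 1"
    using cos_monotone_0_pi[of 0 "(b - a) / 2"] assms by (simp add: c_def)
  have "reciprocal_approx K 0"
  proof (rule reciprocal_approx_zero[where v = "cis \<theta>" and \<delta> = \<delta>])
    show "\<delta> > 0" using c by (simp add: \<delta>_def)
    show "cmod z \<le> 1" if "z \<in> K" for z
      using that by (auto simp: K_def norm_mult)
    show "\<delta> \<le> cmod (z - of_real r * cis \<theta>)" if "z \<in> K" "r \<ge> 0" for z r
    proof -
      from \<open>z \<in> K\<close> obtain t y where z: "z = of_real (exp (- t)) * cis y" "t \<le> T"
        and y: "y \<notin> torus_segment a b"
        by (auto simp: K_def)
      have "\<delta> \<le> sqrt ((1 - c) / 2) * exp (- t)"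
        using z c by (auto simp: \<delta>_def intro!: mult_left_mono)
      also have "\<dots> \<le> cmod (z - of_real r * cis \<theta>)"
        unfolding z using cos_le_off_torus_segment[OF assms(1,2) y] c \<open>r \<ge> 0\<close>
        by (intro dist_ray_ge) (auto simp: \<theta>_def c_def)
      finally show ?thesis .
    qed
  qed simp
  \<comment> \<open>Chosen so that \<open>C * \<epsilon>\<^sup>2 * (2 * pi * T) = 1/2\<close>, below
    the value \<open>1\<close> of the term \<open>n = 0\<close> on the left-hand side.\<close>
  moreover define \<epsilon> where "\<epsilon> = sqrt (1 / (2 * (C * (2 * pi * T))))"
  have "\<epsilon> > 0" using C assms by (simp add: \<epsilon>_def)
  ultimately obtain p where p: "\<And>z. z \<in> K \<Longrightarrow> cmod (z * poly p z - 1) \<le> \<epsilon>"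
    unfolding reciprocal_approx_def by fastforce
  define f where "f = 1 - pCons 0 p"
  have f0: "coeff f 0 = 1" by (simp add: f_def)
  have "summable (\<lambda>n. (cmod (coeff f n))\<^sup>2)"
    by (rule summable_finite[of "{..degree f}"]) (auto simp: coeff_eq_0)
  note obs[OF this]
  also have "(LINT p:{0..T} \<times> (- torus_segment a b \<inter> {0..<2 * pi})|lborel.
                    (cmod (free_solution (coeff f) (fst p) (snd p)))\<^sup>2) \<le> \<epsilon>\<^sup>2 * (2 * pi * T)"
  proof (rule set_integral_observation_le)
    fix t y assume "t \<in> {0..T}" "y \<in> - torus_segment a b"
    hence "of_real (exp (- t)) * cis y \<in> K" unfolding K_def by blast
    from p[OF this] have "cmod (free_solution (coeff f) t y) \<le> \<epsilon>"
      by (simp add: free_solution_coeff f_def norm_minus_commute)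
    thus "(cmod (free_solution (coeff f) (fst (t, y)) (snd (t, y))))\<^sup>2 \<le> \<epsilon>\<^sup>2"
      by (simp add: power_mono)
  qed (use assms in auto)
  also have "C * (\<epsilon>\<^sup>2 * (2 * pi * T)) = 1 / 2"
    using C assms by (simp add: \<epsilon>_def field_simps)
  finally have "(\<Sum>n. (cmod (coeff f n))\<^sup>2 * exp (- 2 * real n * T)) \<le> 1 / 2"
    using C by simp
  \<comment> \<open>The term \<open>n = 0\<close> does not decay in time, so it contributes
    \<open>1\<close> whatever \<open>T\<close> is.\<close>
  moreover have "(\<Sum>n\<in>{0}. (cmod (coeff f n))\<^sup>2 * exp (- 2 * real n * T))
                   \<le> (\<Sum>n. (cmod (coeff f n))\<^sup>2 * exp (- 2 * real n * T))"
  proof (rule sum_le_suminf)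
    show "summable (\<lambda>n. (cmod (coeff f n))\<^sup>2 * exp (- 2 * real n * T))"
      by (rule summable_finite[of "{..degree f}"]) (auto simp: coeff_eq_0)
  qed auto
  ultimately show False using f0 by simp
qed

end
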